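(* Let $A$ be a set, let $0$ be an element of $A$, let $p$ be a prime, let $k \in \mathbb{N}_0$, let $n, m \in \mathbb{N}$, and let $f_1, \ldots, f_m : A^n \to \mathbb{Z}_p$ be functions each of absorbing degree at most $k$. Let $\mathbf{a} \in A^n$. Then there is $U \subseteq \{1,\ldots,n\}$ with $|U| \le km(p-1)$ such that for all $i \in \{1,\ldots,m\}$, we have $f_i (\mathbf{a}) = f_i (\mathbf{a}|_{U})$.
   Context: For $\mathbf{a}\in A^n$ and $J\subseteq\{1,\ldots,n\}$, $\mathbf{a}|_J\in A^n$ is defined by $\mathbf{a}|_J(j)=\mathbf{a}(j)$ for $j\in J$ and $\mathbf{a}|_J(j)=0$ for $j\notin J$. For an abelian group $(B;+,-,0)$ and $g:A^n\to B$: $g$ is absorbing in $I\subseteq\{1,\ldots,n\}$ if $g$ depends only on its arguments with indices in $I$, and $g(\mathbf{a})=0$ whenever $\mathbf{a}(i)=0$ for some $i\in I$. Every $g:A^n\to B$ can be written uniquely as $g=\sum_{I\subseteq\{1,\ldots,n\}} g_I$ with each $g_I:A^n\to B$ absorbing in $I$ (the absorbing decomposition). The absorbing degree of $g$ is $\mathrm{adeg}(g):=\max(\{-1\}\cup\{|J| : J\subseteq\{1,\ldots,n\},\ g_J\neq 0\})$. Here $\mathbb{Z}_p$ is regarded as an abelian group under addition. *)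

theory Defs
  imports "Berlekamp_Zassenhaus.Finite_Field" "HOL-Library.FuncSet"
begin

definition tuples :: "'a set \<Rightarrow> nat \<Rightarrow> (nat \<Rightarrow> 'a) set" where
  "tuples A n = {1..n} \<rightarrow>\<^sub>E A"

definition restrict_tuple :: "'a \<Rightarrow> nat \<Rightarrow> (nat \<Rightarrow> 'a) \<Rightarrow> nat set \<Rightarrow> nat \<Rightarrow> 'a" where
  "restrict_tuple z n a J = (\<lambda>j\<in>{1..n}. if j \<in> J then a j else z)"

text \<open>Maps out of \<open>A\<^sup>n\<close> are total functions on \<open>nat \<Rightarrow> 'a\<close>; only their values on
  \<^term>\<open>tuples A n\<close> are ever constrained. The parameter \<open>z\<close> is the distinguished element
  0 of \<open>A\<close>.\<close>

definition absorbing_in ::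
  "'a set \<Rightarrow> 'a \<Rightarrow> nat \<Rightarrow> nat set \<Rightarrow> ((nat \<Rightarrow> 'a) \<Rightarrow> 'b::ab_group_add) \<Rightarrow> bool" where
  "absorbing_in A z n I g \<longleftrightarrow>
     (\<forall>a\<in>tuples A n. \<forall>b\<in>tuples A n. (\<forall>i\<in>I. a i = b i) \<longrightarrow> g a = g b) \<and>
     (\<forall>a\<in>tuples A n. (\<exists>i\<in>I. a i = z) \<longrightarrow> g a = 0)"

text \<open>The extensionality requirement on \<open>G\<close> makes the decomposition unique as a HOL function.\<close>

definition absorbing_decomposition ::
  "'a set \<Rightarrow> 'a \<Rightarrow> nat \<Rightarrow> ((nat \<Rightarrow> 'a) \<Rightarrow> 'b::ab_group_add) \<Rightarrow>
    (nat set \<Rightarrow> (nat \<Rightarrow> 'a) \<Rightarrow> 'b) \<Rightarrow> bool" where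
  "absorbing_decomposition A z n g G \<longleftrightarrow>
     G \<in> Pow {1..n} \<rightarrow>\<^sub>E (tuples A n \<rightarrow>\<^sub>E UNIV) \<and>
     (\<forall>I\<in>Pow {1..n}. absorbing_in A z n I (G I)) \<and>
     (\<forall>a\<in>tuples A n. g a = (\<Sum>I\<in>Pow {1..n}. G I a))"

definition absorbing_part ::
  "'a set \<Rightarrow> 'a \<Rightarrow> nat \<Rightarrow> ((nat \<Rightarrow> 'a) \<Rightarrow> 'b::ab_group_add) \<Rightarrow> nat set \<Rightarrow> (nat \<Rightarrow> 'a) \<Rightarrow> 'b" where
  "absorbing_part A z n g = (THE G. absorbing_decomposition A z n g G)"

definition adeg :: "'a set \<Rightarrow> 'a \<Rightarrow> nat \<Rightarrow> ((nat \<Rightarrow> 'a) \<Rightarrow> 'b::ab_group_add) \<Rightarrow> int" where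
  "adeg A z n g =
     Max ({-1} \<union> {int (card J) |J. J \<subseteq> {1..n} \<and> (\<exists>a\<in>tuples A n. absorbing_part A z n g J a \<noteq> 0)})"

lemma restrict_tuple_in:
  assumes "z \<in> A" "a \<in> tuples A n"
  shows "restrict_tuple z n a J \<in> tuples A n"
  using assms by (auto simp: tuples_def restrict_tuple_def)

lemma absorbing_in_restrict_eq:
  assumes "absorbing_in A z n I g" "I \<subseteq> {1..n}" "z \<in> A" "a \<in> tuples A n"
  shows "g (restrict_tuple z n a J) = (if I \<subseteq> J then g a else 0)"
proof (cases "I \<subseteq> J")
  case True
  then have "\<forall>i\<in>I. restrict_tuple z n a J i = a i"
    using assms(2) by (auto simp: restrict_tuple_def)
  then have "g (restrict_tuple z n a J) = g a"
    using assms(1,4) restrict_tuple_in[OF assms(3,4)] unfolding absorbing_in_def by blast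
  with True show ?thesis by simp
next
  case False
  then have "\<exists>i\<in>I. restrict_tuple z n a J i = z"
    using assms(2) by (auto simp: restrict_tuple_def subset_iff)
  then have "g (restrict_tuple z n a J) = 0"
    using assms(1) restrict_tuple_in[OF assms(3,4)] unfolding absorbing_in_def by blast
  with False show ?thesis by simp
qed

lemma absorbing_decomposition_restrict:
  assumes "absorbing_decomposition A z n g G" "J \<subseteq> {1..n}" "z \<in> A" "a \<in> tuples A n"
  shows "g (restrict_tuple z n a J) = (\<Sum>I\<in>Pow J. G I a)"
proof -
  have "g (restrict_tuple z n a J) = (\<Sum>I\<in>Pow {1..n}. G I (restrict_tuple z n a J))"
    using assms restrict_tuple_in[OF assms(3,4)] unfolding absorbing_decomposition_def by blast
  also have "\<dots> = (\<Sum>I\<in>Pow {1..n}. if I \<subseteq> J then G I a else 0)"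
  proof (rule sum.cong[OF refl])
    fix I assume I: "I \<in> Pow {1..n}"
    then have "absorbing_in A z n I (G I)"
      using assms(1) unfolding absorbing_decomposition_def by blast
    then show "G I (restrict_tuple z n a J) = (if I \<subseteq> J then G I a else 0)"
      using I by (intro absorbing_in_restrict_eq[OF _ _ assms(3,4)]) auto
  qed
  also have "\<dots> = (\<Sum>I\<in>Pow J. G I a)"
    using assms(2) by (intro sum.mono_neutral_cong_right) auto
  finally show ?thesis .
qed

lemma absorbing_decomposition_unique:
  assumes z: "z \<in> A" and G: "absorbing_decomposition A z n g G"
    and H: "absorbing_decomposition A z n g H"
  shows "G = H"
proof -
  have eq: "G I a = H I a" if "a \<in> tuples A n" "I \<subseteq> {1..n}" for a I
  proof -
    have "finite I" using that(2) finite_subset by blast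
    then show ?thesis using that(2)
    proof (induction I rule: finite_psubset_induct)
      case (psubset I)
      have fin: "finite (Pow I)" using psubset by simp
      have "(\<Sum>K\<in>Pow I. G K a) = (\<Sum>K\<in>Pow I. H K a)"
        using absorbing_decomposition_restrict[OF G psubset.prems z that(1)]
          absorbing_decomposition_restrict[OF H psubset.prems z that(1)] by simp
      then have "G I a + (\<Sum>K\<in>Pow I - {I}. G K a) = H I a + (\<Sum>K\<in>Pow I - {I}. H K a)"
        using fin by (simp add: sum.remove[of "Pow I" I])
      moreover have "(\<Sum>K\<in>Pow I - {I}. G K a) = (\<Sum>K\<in>Pow I - {I}. H K a)"
        using psubset by (intro sum.cong) auto
      ultimately show ?case by simp
    qed
  qed
  show ?thesis
  proof
    fix I
    show "G I = H I"
    proof (cases "I \<in> Pow {1..n}")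
      case True
      then have "G I \<in> tuples A n \<rightarrow>\<^sub>E UNIV" "H I \<in> tuples A n \<rightarrow>\<^sub>E UNIV"
        using G H unfolding absorbing_decomposition_def by (auto simp: PiE_iff)
      then show ?thesis using eq True by (intro PiE_ext) auto
    next
      case False
      then show ?thesis
        using G H unfolding absorbing_decomposition_def by (metis PiE_arb)
    qed
  qed
qed

lemma sum_Pow_insert_split:
  assumes "finite S" "x \<notin> S"
  shows "(\<Sum>I\<in>Pow (insert x S). h I) = (\<Sum>I\<in>Pow S. h I) + (\<Sum>I\<in>Pow S. h (insert x I))"
proof -
  have "inj_on (insert x) (Pow S)"
    using assms(2) by (auto simp: inj_on_def)
  moreover have "Pow S \<inter> insert x ` Pow S = {}"
    using assms(2) by auto
  ultimately show ?thesis
    using assms by (simp add: Pow_insert sum.union_disjoint sum.reindex)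
qed

lemma absorbing_decomposition_exists_aux:
  fixes g :: "(nat \<Rightarrow> 'a) \<Rightarrow> 'b::ab_group_add"
  assumes z: "z \<in> A" and "finite S" "S \<subseteq> {1..n}"
    and "\<And>a b. a \<in> tuples A n \<Longrightarrow> b \<in> tuples A n \<Longrightarrow> (\<forall>i\<in>S. a i = b i) \<Longrightarrow> g a = g b"
  shows "\<exists>G. (\<forall>I\<in>Pow S. absorbing_in A z n I (G I)) \<and>
             (\<forall>a\<in>tuples A n. g a = (\<Sum>I\<in>Pow S. G I a))"
  using assms(2-)
proof (induction S arbitrary: g rule: finite_induct)
  case empty
  have "absorbing_in A z n {} g"
    unfolding absorbing_in_def using empty.prems(2) by blast
  then show ?case by (intro exI[of _ "\<lambda>_. g"]) simp
next
  case (insert x S)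
  define g0 where "g0 a = g (a(x := z))" for a
  have x: "x \<in> {1..n}" using insert.prems(1) by simp
  have upd': "a(x := c) \<in> tuples A n" if "a \<in> tuples A n" "c \<in> A" for a c
    using that x by (auto simp: tuples_def PiE_iff extensional_def)
  then have upd: "a(x := z) \<in> tuples A n" if "a \<in> tuples A n" for a
    using upd' that z by simp
  have "\<exists>G. (\<forall>I\<in>Pow S. absorbing_in A z n I (G I)) \<and>
             (\<forall>a\<in>tuples A n. g0 a = (\<Sum>I\<in>Pow S. G I a))"
  proof (rule insert.IH)
    show "S \<subseteq> {1..n}" using insert.prems(1) by simp
    fix a b assume ab: "a \<in> tuples A n" "b \<in> tuples A n" "\<forall>i\<in>S. a i = b i"
    show "g0 a = g0 b"
      unfolding g0_def using ab by (intro insert.prems(2) upd) auto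
  qed
  then obtain G where G: "\<And>I. I \<subseteq> S \<Longrightarrow> absorbing_in A z n I (G I)"
    "\<And>a. a \<in> tuples A n \<Longrightarrow> g0 a = (\<Sum>I\<in>Pow S. G I a)" by auto
  have slice: "\<exists>H. (\<forall>I\<in>Pow S. absorbing_in A z n I (H I)) \<and>
             (\<forall>a\<in>tuples A n. g (a(x := c)) - g0 a = (\<Sum>I\<in>Pow S. H I a))" if c: "c \<in> A" for c
  proof (rule insert.IH)
    show "S \<subseteq> {1..n}" using insert.prems(1) by simp
    fix a b assume ab: "a \<in> tuples A n" "b \<in> tuples A n" "\<forall>i\<in>S. a i = b i"
    have "g (a(x := c)) = g (b(x := c))"
      using ab c by (intro insert.prems(2) upd') auto
    moreover have "g (a(x := z)) = g (b(x := z))"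
      using ab by (intro insert.prems(2) upd) auto
    ultimately show "g (a(x := c)) - g0 a = g (b(x := c)) - g0 b"
      by (simp add: g0_def)
  qed
  have "\<forall>c\<in>A. \<exists>H. (\<forall>I\<in>Pow S. absorbing_in A z n I (H I)) \<and>
             (\<forall>a\<in>tuples A n. g (a(x := c)) - g0 a = (\<Sum>I\<in>Pow S. H I a))"
    using slice by blast
  then obtain H where "\<forall>c\<in>A. (\<forall>I\<in>Pow S. absorbing_in A z n I (H c I)) \<and>
             (\<forall>a\<in>tuples A n. g (a(x := c)) - g0 a = (\<Sum>I\<in>Pow S. H c I a))"
    by (rule bchoice[THEN exE])
  then have H: "\<And>c I. c \<in> A \<Longrightarrow> I \<subseteq> S \<Longrightarrow> absorbing_in A z n I (H c I)"
    "\<And>c a. c \<in> A \<Longrightarrow> a \<in> tuples A n \<Longrightarrow> g (a(x := c)) - g0 a = (\<Sum>I\<in>Pow S. H c I a)"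
    by blast+
  define K where
    "K I a = (if x \<in> I then if a x = z then 0 else H (a x) (I - {x}) a else G I a)" for I a
  have mem: "a x \<in> A" if "a \<in> tuples A n" for a
    using that x by (auto simp: tuples_def)
  have "absorbing_in A z n I (K I)" if I: "I \<subseteq> insert x S" for I
  proof (cases "x \<in> I")
    case False
    then have "I \<subseteq> S" "K I = G I" using I by (auto simp: K_def)
    then show ?thesis using G by simp
  next
    case True
    have J: "I - {x} \<subseteq> S" using I by auto
    note J' = H(1)[OF _ J, unfolded absorbing_in_def]
    show ?thesis
      unfolding absorbing_in_def
    proof (intro conjI ballI impI)
      fix a b assume ab: "a \<in> tuples A n" "b \<in> tuples A n" "\<forall>i\<in>I. a i = b i"
      then have ax: "a x = b x" using True by blast
      have "H (b x) (I - {x}) a = H (b x) (I - {x}) b"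
        using J'[OF mem[OF ab(2)]] ab by blast
      then show "K I a = K I b" by (simp add: K_def ax True)
    next
      fix a assume a: "a \<in> tuples A n" "\<exists>i\<in>I. a i = z"
      show "K I a = 0"
      proof (cases "a x = z")
        case False
        then have "\<exists>i\<in>I - {x}. a i = z" using a(2) by blast
        then have "H (a x) (I - {x}) a = 0"
          using J'[OF mem[OF a(1)]] a(1) by blast
        then show ?thesis by (simp add: K_def True)
      qed (simp add: K_def True)
    qed
  qed
  moreover have "g a = (\<Sum>I\<in>Pow (insert x S). K I a)" if a: "a \<in> tuples A n" for a
  proof -
    have 1: "(\<Sum>I\<in>Pow S. K I a) = g0 a"
      using G(2)[OF a] insert.hyps by (auto simp: K_def intro!: sum.cong)
    have 2: "(\<Sum>I\<in>Pow S. K (insert x I) a) = g a - g0 a"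
    proof (cases "a x = z")
      case True
      then have "a(x := z) = a" by auto
      then show ?thesis using True by (simp add: K_def g0_def)
    next
      case False
      have "(\<Sum>I\<in>Pow S. K (insert x I) a) = (\<Sum>I\<in>Pow S. H (a x) I a)"
      proof (rule sum.cong[OF refl])
        fix I assume "I \<in> Pow S"
        then have "insert x I - {x} = I" using insert.hyps by auto
        then show "K (insert x I) a = H (a x) I a" using False by (simp add: K_def)
      qed
      then show ?thesis using H(2)[OF mem[OF a] a] by simp
    qed
    show ?thesis
      using 1 2 insert.hyps by (simp add: sum_Pow_insert_split)
  qed
  ultimately show ?case by (intro exI[of _ K]) auto
qed

lemma absorbing_in_cong:
  assumes "absorbing_in A z n I g" "\<And>a. a \<in> tuples A n \<Longrightarrow> h a = g a"
  shows "absorbing_in A z n I h"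
  unfolding absorbing_in_def
proof (intro conjI ballI impI)
  fix a b assume ab: "a \<in> tuples A n" "b \<in> tuples A n" "\<forall>i\<in>I. a i = b i"
  have "g a = g b" using assms(1) ab unfolding absorbing_in_def by blast
  then show "h a = h b" using assms(2)[OF ab(1)] assms(2)[OF ab(2)] by argo
next
  fix a assume a: "a \<in> tuples A n" "\<exists>i\<in>I. a i = z"
  have "g a = 0" using assms(1) a unfolding absorbing_in_def by blast
  then show "h a = 0" using assms(2)[OF a(1)] by argo
qed

lemma absorbing_decomposition_ex1:
  fixes g :: "(nat \<Rightarrow> 'a) \<Rightarrow> 'b::ab_group_add"
  assumes z: "z \<in> A"
  shows "\<exists>!G. absorbing_decomposition A z n g G"
proof -
  have eqI: "a = b" if "a \<in> tuples A n" "b \<in> tuples A n" "\<forall>i\<in>{1..n}. a i = b i" for a b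
    using that unfolding tuples_def by (intro PiE_ext) auto
  have "\<exists>G. (\<forall>I\<in>Pow {1..n}. absorbing_in A z n I (G I)) \<and>
             (\<forall>a\<in>tuples A n. g a = (\<Sum>I\<in>Pow {1..n}. G I a))"
  proof (rule absorbing_decomposition_exists_aux[OF z])
    fix a b assume "a \<in> tuples A n" "b \<in> tuples A n" "\<forall>i\<in>{1..n}. a i = b i"
    then show "g a = g b" using eqI by metis
  qed auto
  then obtain G where G: "\<And>I. I \<subseteq> {1..n} \<Longrightarrow> absorbing_in A z n I (G I)"
    "\<And>a. a \<in> tuples A n \<Longrightarrow> g a = (\<Sum>I\<in>Pow {1..n}. G I a)" by auto
  have "absorbing_decomposition A z n g (\<lambda>I\<in>Pow {1..n}. \<lambda>a\<in>tuples A n. G I a)"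
    unfolding absorbing_decomposition_def
  proof (intro conjI ballI)
    fix I assume I: "I \<in> Pow {1..n}"
    then have "absorbing_in A z n I (G I)" using G(1) by blast
    moreover have "(\<lambda>a\<in>tuples A n. G I a) a = G I a" if "a \<in> tuples A n" for a
      using that by simp
    ultimately have "absorbing_in A z n I (\<lambda>a\<in>tuples A n. G I a)"
      by (rule absorbing_in_cong)
    then show "absorbing_in A z n I ((\<lambda>I\<in>Pow {1..n}. \<lambda>a\<in>tuples A n. G I a) I)"
      using I by simp
  next
    fix a assume "a \<in> tuples A n"
    then show "g a = (\<Sum>I\<in>Pow {1..n}. (\<lambda>I\<in>Pow {1..n}. \<lambda>a\<in>tuples A n. G I a) I a)"
      using G(2) by simp
  qed auto
  then show ?thesis using absorbing_decomposition_unique[OF z] by blast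
qed

lemma absorbing_decomposition_absorbing_part:
  "z \<in> A \<Longrightarrow> absorbing_decomposition A z n g (absorbing_part A z n g)"
  unfolding absorbing_part_def by (rule theI'[OF absorbing_decomposition_ex1])

end

theory Submission
  imports Defs
begin

text \<open>
  For \<open>U \<subseteq> {1..n}\<close> the value \<open>f\<^sub>i (a|\<^sub>U)\<close> is a multilinear polynomial of degree at most \<open>k\<close> in the
  indicator variables of \<open>U\<close>. Choose \<open>U\<close> of minimal size with \<open>f\<^sub>i (a|\<^sub>U) = f\<^sub>i a\<close> for all \<open>i\<close>.
  By Fermat, \<open>V \<mapsto> \<Prod>\<^sub>i (1 - (f\<^sub>i (a|\<^sub>V) - f\<^sub>i a)\<^bsup>p - 1\<^esup>)\<close> is then the indicator function of
  \<open>V = U\<close> among the subsets of \<open>U\<close>, so its degree is \<open>|U|\<close>; but it has degree at most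
  \<open>k m (p - 1)\<close> by construction.
\<close>

text \<open>The generator given by \<open>I\<close> and \<open>c\<close> is the monomial
  \<open>c\<close> times the product of the variables indexed by \<open>I\<close>, evaluated at the
  0/1 indicator vector of \<open>V\<close>. Generating by sums allows each degree bound to be proved
  by induction, without choosing coefficients.\<close>

inductive set_degree_le :: "nat \<Rightarrow> ('i set \<Rightarrow> 'b::comm_ring_1) \<Rightarrow> bool" for d where
  monomial: "finite I \<Longrightarrow> card I \<le> d \<Longrightarrow> set_degree_le d (\<lambda>V. if I \<subseteq> V then c else 0)"
| add: "set_degree_le d g \<Longrightarrow> set_degree_le d h \<Longrightarrow> set_degree_le d (\<lambda>V. g V + h V)"

lemma set_degree_le_const: "set_degree_le d (\<lambda>V. c)"
  using set_degree_le.monomial[of "{}" d c] by simp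

lemma set_degree_le_sum:
  assumes "finite S" "\<And>x. x \<in> S \<Longrightarrow> set_degree_le d (g x)"
  shows "set_degree_le d (\<lambda>V. \<Sum>x\<in>S. g x V)"
  using assms
  by (induction S rule: finite_induct) (auto intro: set_degree_le_const set_degree_le.add)

text \<open>Indicator variables are idempotent, so the monomials of \<open>I\<close> and
  \<open>J\<close> multiply to that of \<open>I \<union> J\<close>, whose size is at most
  \<open>d + e\<close>. Distributivity does the rest.\<close>

lemma set_degree_le_mult:
  assumes "set_degree_le d g" "set_degree_le e h"
  shows "set_degree_le (d + e) (\<lambda>V. g V * h V)"
  using assms(1)
proof induction
  case (monomial I c)
  from assms(2) show ?case
  proof induction
    case (monomial J c')
    have "card (I \<union> J) \<le> d + e"
      using card_Un_le[of I J] \<open>card I \<le> d\<close> monomial by linarith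
    then have "set_degree_le (d + e) (\<lambda>V. if I \<union> J \<subseteq> V then c * c' else 0)"
      using \<open>finite I\<close> monomial by (intro set_degree_le.monomial) auto
    moreover have "(\<lambda>V. (if I \<subseteq> V then c else 0) * (if J \<subseteq> V then c' else 0))
        = (\<lambda>V. if I \<union> J \<subseteq> V then c * c' else 0)"
      by auto
    ultimately show ?case by simp
  next
    case (add g h)
    then show ?case unfolding distrib_left by (intro set_degree_le.add)
  qed
next
  case (add g h)
  then show ?case unfolding distrib_right by (intro set_degree_le.add)
qed

lemma set_degree_le_minus:
  assumes "set_degree_le d g" "set_degree_le d h"
  shows "set_degree_le d (\<lambda>V. g V - h V)"
proof -
  have "set_degree_le (0 + d) (\<lambda>V. (- 1) * h V)"
    by (intro set_degree_le_mult set_degree_le_const assms)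
  from set_degree_le.add[OF assms(1) this[simplified]] show ?thesis by simp
qed

lemma set_degree_le_power:
  "set_degree_le d g \<Longrightarrow> set_degree_le (d * e) (\<lambda>V. g V ^ e)"
  by (induction e) (auto intro: set_degree_le_const set_degree_le_mult)

lemma set_degree_le_prod:
  assumes "finite S" "\<And>x. x \<in> S \<Longrightarrow> set_degree_le d (g x)"
  shows "set_degree_le (d * card S) (\<lambda>V. \<Prod>x\<in>S. g x V)"
  using assms
  by (induction S rule: finite_induct) (auto intro: set_degree_le_const set_degree_le_mult)

text \<open>Up to sign the sum is the coefficient of the monomial of \<open>U\<close>, by Moebius
  inversion. For a single monomial, some \<open>x\<close> in \<open>U\<close> lies outside
  \<open>I\<close>; adding \<open>x\<close> to \<open>V\<close> flips the sign but not the truth of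
  \<open>I \<subseteq> V\<close>, so the terms cancel in pairs.\<close>

lemma set_degree_le_alternating_sum:
  assumes "set_degree_le d h" "finite U" "d < card U"
  shows "(\<Sum>V\<in>Pow U. (- 1) ^ card V * h V) = 0"
  using assms(1)
proof induction
  case (monomial I c)
  have "\<not> U \<subseteq> I"
    using card_mono[OF \<open>finite I\<close>, of U] monomial assms(3) by linarith
  then obtain x where x: "x \<in> U" "x \<notin> I" by blast
  let ?h = "\<lambda>V. (- 1) ^ card V * (if I \<subseteq> V then c else 0)"
  have "(\<Sum>V\<in>Pow (U - {x}). ?h (insert x V)) = (\<Sum>V\<in>Pow (U - {x}). - ?h V)"
  proof (rule sum.cong[OF refl])
    fix V assume "V \<in> Pow (U - {x})"
    then have "card (insert x V) = Suc (card V)"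
      using assms(2) by (subst card_insert_disjoint) (auto intro: finite_subset)
    then show "?h (insert x V) = - ?h V"
      using x by (simp add: subset_insert)
  qed
  then show ?case
    using sum_Pow_insert_split[of "U - {x}" x ?h] assms(2) x
    by (simp add: insert_absorb sum_negf)
next
  case (add g h)
  then show ?case by (simp add: distrib_left sum.distrib)
qed

text \<open>If \<open>d < card U\<close>, the alternating sum over \<open>Pow U\<close> would
  vanish, yet its only surviving term is \<open>h U\<close> up to sign.\<close>

lemma card_le_if_set_degree_le_indicator:
  assumes "set_degree_le d h" "finite U" "h U \<noteq> 0" "\<And>V. V \<subset> U \<Longrightarrow> h V = 0"
  shows "card U \<le> d"
proof (rule ccontr)
  assume "\<not> card U \<le> d"
  then have "0 = (\<Sum>V\<in>Pow U. (- 1) ^ card V * h V)"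
    using set_degree_le_alternating_sum assms(1,2) by (metis not_le)
  also have "\<dots> = (\<Sum>V\<in>{U}. (- 1) ^ card V * h V)"
    using assms(2) by (intro sum.mono_neutral_right) (auto simp: assms(4) psubset_eq)
  finally show False
    using assms(3) by (cases "even (card U)") auto
qed

lemma mod_ring_power_card_minus_1:
  fixes x :: "'p::prime_card mod_ring"
  assumes "x \<noteq> 0"
  shows "x ^ (CARD('p) - 1) = 1"
proof -
  have "CARD('p) \<ge> 2" by (rule prime_ge_2_nat[OF prime_card])
  then have "CARD('p) - 1 = Suc (CARD('p) - 2)" by simp
  \<comment> \<open>In \<open>mod_ring\<close> the inverse of a nonzero \<open>x\<close> is by
    definition \<open>x ^ (CARD('p) - 2)\<close>.\<close>
  then have "x ^ (CARD('p) - 1) = x * inverse x"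
    using assms by (simp add: inverse_mod_ring_def nat_diff_distrib)
  then show ?thesis using assms by simp
qed

lemma set_degree_le_common_value:
  fixes F :: "'j \<Rightarrow> 'i set \<Rightarrow> 'p::prime_card mod_ring"
  assumes "finite S" "finite N" "\<And>i. i \<in> S \<Longrightarrow> set_degree_le k (F i)"
  shows "\<exists>U\<subseteq>N. card U \<le> k * card S * (CARD('p) - 1) \<and> (\<forall>i\<in>S. F i U = F i N)"
proof -
  define P where "P U \<longleftrightarrow> U \<subseteq> N \<and> (\<forall>i\<in>S. F i U = F i N)" for U
  have "P N" by (simp add: P_def)
  then obtain U where U: "P U" and min: "\<And>V. P V \<Longrightarrow> card U \<le> card V"
    using arg_min_nat_lemma[of P N card] by blast
  have "finite U" using U assms(2) by (auto simp: P_def intro: finite_subset)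
  define h where "h V = (\<Prod>i\<in>S. 1 - (F i V - F i N) ^ (CARD('p) - 1))" for V
  have "set_degree_le (k * (CARD('p) - 1) * card S) h"
    unfolding h_def
    by (intro set_degree_le_prod set_degree_le_minus set_degree_le_const set_degree_le_power assms)
  \<comment> \<open>With exponent 0 the convention \<open>0 ^ 0 = 1\<close> would make the factors
    of \<open>h U\<close> vanish; a positive exponent makes each of them 1.\<close>
  moreover have "CARD('p) - 1 > 0"
    using prime_gt_1_nat[OF prime_card[where 'a = 'p]] by simp
  then have "h U \<noteq> 0" using U by (simp add: h_def P_def zero_power)
  moreover have "h V = 0" if "V \<subset> U" for V
  proof -
    \<comment> \<open>A proper subset of \<open>U\<close> is smaller, so minimality yields an
      \<open>i\<close> with a nonzero difference, whose factor is \<open>1 - 1\<close>.\<close>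
    have "\<not> P V" using min psubset_card_mono[OF \<open>finite U\<close> that] by (meson not_le)
    moreover have "V \<subseteq> N" using that U by (auto simp: P_def)
    ultimately obtain i where "i \<in> S" "F i V - F i N \<noteq> 0"
      by (auto simp: P_def)
    then show ?thesis
      unfolding h_def
      by (intro prod_zero[OF assms(1)] bexI[of _ i]) (simp_all add: mod_ring_power_card_minus_1 del: One_nat_def)
  qed
  ultimately have "card U \<le> k * (CARD('p) - 1) * card S"
    using \<open>finite U\<close> by (intro card_le_if_set_degree_le_indicator)
  then show ?thesis
    using U unfolding P_def by (intro exI[of _ U]) (simp add: ac_simps)
qed

lemma absorbing_part_eq_0_if_adeg_less:
  assumes "adeg A z n g < int (card J)" "J \<subseteq> {1..n}" "a \<in> tuples A n"
  shows "absorbing_part A z n g J a = 0"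
proof (rule ccontr)
  assume "absorbing_part A z n g J a \<noteq> 0"
  then have "int (card J) \<le> adeg A z n g"
    unfolding adeg_def using assms(2,3) by (intro Max_ge) auto
  then show False using assms(1) by simp
qed

text \<open>Restricting \<open>a\<close> to \<open>V\<close> kills the absorbing parts with index
  set not inside \<open>V\<close> and leaves the others at their value in \<open>a\<close>. These
  values are the coefficients of \<open>h\<close>, and those for index sets larger than
  \<open>k\<close> are zero.\<close>

lemma restrict_tuple_set_degree_le:
  fixes g :: "(nat \<Rightarrow> 'a) \<Rightarrow> 'b::comm_ring_1"
  assumes "z \<in> A" "a \<in> tuples A n" "adeg A z n g \<le> int k"
  obtains h where "set_degree_le k h"
    "\<And>V. V \<subseteq> {1..n} \<Longrightarrow> g (restrict_tuple z n a V) = h V"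
proof
  let ?G = "absorbing_part A z n g"
  let ?h = "\<lambda>V. \<Sum>I\<in>Pow {1..n}. if I \<subseteq> V then ?G I a else 0"
  show "set_degree_le k ?h"
  proof (rule set_degree_le_sum)
    fix I assume I: "I \<in> Pow {1..n}"
    show "set_degree_le k (\<lambda>V. if I \<subseteq> V then ?G I a else 0)"
    proof (cases "card I \<le> k")
      case True
      then show ?thesis using I by (intro set_degree_le.monomial) (auto intro: finite_subset)
    next
      case False
      then have "?G I a = 0"
        using I assms by (intro absorbing_part_eq_0_if_adeg_less) auto
      then show ?thesis using set_degree_le_const[of k 0] by (simp cong: if_cong)
    qed
  qed simp
  fix V :: "nat set" assume V: "V \<subseteq> {1..n}"
  have "g (restrict_tuple z n a V) = (\<Sum>I\<in>Pow V. ?G I a)"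
    using absorbing_decomposition_restrict[OF
        absorbing_decomposition_absorbing_part[OF assms(1)] V assms(1,2)] .
  also have "\<dots> = ?h V"
    using V by (intro sum.mono_neutral_cong_left) auto
  finally show "g (restrict_tuple z n a V) = ?h V" .
qed

theorem theorem3p3:
  fixes A :: "'a set" and z :: 'a and p k n m :: nat
    and f :: "nat \<Rightarrow> (nat \<Rightarrow> 'a) \<Rightarrow> 'p::prime_card mod_ring"
    and a :: "nat \<Rightarrow> 'a"
  assumes "z \<in> A"
    and "prime p" and "CARD('p) = p"
    and "n \<ge> 1" and "m \<ge> 1"
    and "\<forall>i\<in>{1..m}. adeg A z n (f i) \<le> int k"
    and "a \<in> tuples A n"
  shows "\<exists>U. U \<subseteq> {1..n} \<and> card U \<le> k * m * (p - 1) \<and>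
           (\<forall>i\<in>{1..m}. f i a = f i (restrict_tuple z n a U))"
proof -
  have "\<forall>i\<in>{1..m}. \<exists>h. set_degree_le k h \<and>
      (\<forall>V\<subseteq>{1..n}. f i (restrict_tuple z n a V) = h V)"
    using restrict_tuple_set_degree_le[OF assms(1,7)] assms(6) by metis
  then obtain F where F: "\<And>i. i \<in> {1..m} \<Longrightarrow> set_degree_le k (F i)"
    "\<And>i V. i \<in> {1..m} \<Longrightarrow> V \<subseteq> {1..n} \<Longrightarrow> f i (restrict_tuple z n a V) = F i V"
    by metis
  obtain U where U: "U \<subseteq> {1..n}" "card U \<le> k * card {1..m} * (CARD('p) - 1)"
    "\<forall>i\<in>{1..m}. F i U = F i {1..n}"
    using set_degree_le_common_value[of "{1..m}" "{1..n}" k F] F(1) by auto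
  \<comment> \<open>Equality as functions on all of \<open>nat\<close> holds because tuples are
    extensional; it turns the reference value \<open>F i {1..n}\<close> into
    \<open>f i a\<close>.\<close>
  have "restrict_tuple z n a {1..n} = a"
    using assms(7) by (auto simp: restrict_tuple_def tuples_def PiE_def extensional_def)
  then have "f i a = f i (restrict_tuple z n a U)" if "i \<in> {1..m}" for i
    using F(2)[OF that U(1)] F(2)[OF that, of "{1..n}"] U(3) that by simp
  then show ?thesis
    using U(1,2) assms(3) by (intro exI[of _ U]) simp
qed

end
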